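(* Let $n$ range over even integers, and let $d=d(n)=n/2-\eta$, where $\eta=\eta(n)$ satisfies $\eta=\omega(1)$ and $\eta=o(n)$. Then the sharp $d$-threshold for containing a perfect matching is $8\eta/n^2$. That is, for every fixed $\epsilon>0$: (0) there exists a sequence of $n$-vertex graphs $\{H_n\}$ ($n$ even) with $\delta(H_n)\geq d$ such that, if $p\leq(1-\epsilon)8\eta/n^2$, then $\lim_{n\to\infty}\mathbb{P}[H_n\cup G(n,p)\text{ contains a perfect matching}]=0$; and (1) for every sequence of $n$-vertex graphs $\{H_n\}$ ($n$ even) with $\delta(H_n)\geq d$, if $p\geq(1+\epsilon)8\eta/n^2$, then $\lim_{n\to\infty}\mathbb{P}[H_n\cup G(n,p)\text{ contains a perfect matching}]=1$.
   Context: All graphs are simple. A perfect matching is a set of $n/2$ pairwise disjoint edges. $G(n,p)$ is the binomial random graph on the same $n$-vertex set as $H_n$, obtained by including each of the $\binom{n}{2}$ possible edges independently with probability $p$; $H_n\cup G(n,p)$ is the union of the edge sets. $\delta(\cdot)$ denotes minimum degree. Asymptotic notation is as $n\to\infty$. *)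

theory Defs
  imports "HOL-Probability.Probability" "HOL-Library.Ramsey" "HOL-Library.Landau_Symbols"
begin

text \<open>A simple graph on vertex set \<open>V\<close> is represented by its edge set, a set of
  two-element subsets of \<open>V\<close>.\<close>

definition simple_graph :: "'a set \<Rightarrow> 'a set set \<Rightarrow> bool" where
  "simple_graph V E \<longleftrightarrow> E \<subseteq> nsets V 2"

definition degree :: "'a set set \<Rightarrow> 'a \<Rightarrow> nat" where
  "degree E v = card {e \<in> E. v \<in> e}"

text \<open>Meaningful only for finite nonempty \<open>V\<close>.\<close>

definition min_degree :: "'a set \<Rightarrow> 'a set set \<Rightarrow> nat" where
  "min_degree V E = Min (degree E ` V)"

definition perfect_matching :: "'a set \<Rightarrow> 'a set set \<Rightarrow> 'a set set \<Rightarrow> bool" where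
  "perfect_matching V E M \<longleftrightarrow> M \<subseteq> E \<and> disjoint M \<and> 2 * card M = card V"

definition has_perfect_matching :: "'a set \<Rightarrow> 'a set set \<Rightarrow> bool" where
  "has_perfect_matching V E \<longleftrightarrow> (\<exists>M. perfect_matching V E M)"

definition binomial_random_graph :: "'a set \<Rightarrow> real \<Rightarrow> 'a set set pmf" where
  "binomial_random_graph V p =
     map_pmf (\<lambda>f. {e \<in> nsets V 2. f e}) (Pi_pmf (nsets V 2) False (\<lambda>_. bernoulli_pmf p))"

definition prob_perfect_matching :: "nat \<Rightarrow> nat set set \<Rightarrow> real \<Rightarrow> real" where
  "prob_perfect_matching n H p =
     measure_pmf.prob (binomial_random_graph {..<n} p)
       {G. has_perfect_matching {..<n} (H \<union> G)}"

text \<open>The filter for \<open>n \<rightarrow> \<infinity>\<close> along the even integers.\<close>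

definition even_at_top :: "nat filter" where
  "even_at_top = inf at_top (principal {n. even n})"

end

theory Submission
  imports Defs
begin

text \<open>
  Lower bound: take all pairs not inside a set \<open>A\<close> of \<open>n/2 + \<lfloor>\<eta>\<rfloor>\<close> vertices. A perfect matching uses
  at least \<open>\<lfloor>\<eta>\<rfloor>\<close> random edges inside \<open>A\<close>, whose expected number is about \<open>(1 - \<epsilon>) \<eta>\<close>.

  Upper bound: let a graph with minimum degree \<open>k\<close> have a maximum matching missing two vertices
  \<open>a\<close>, \<open>b\<close>. Rotating at \<open>a\<close> uncovers any of \<open>k\<close> vertices \<open>u\<close> instead of \<open>a\<close>, and then rotating at
  \<open>b\<close> uncovers any of \<open>k\<close> vertices \<open>v\<close> instead of \<open>b\<close>; adding the pair \<open>{u, v}\<close> enlarges the matching.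
  So at least \<open>k\<^sup>2/2 \<approx> n\<^sup>2/8\<close> pairs are augmenting, whatever has been added already, while \<open>H\<close> alone
  has a matching of size \<open>k\<close> and needs at most \<open>\<eta>\<close> augmentations. The expectation of \<open>x\<close> to the
  power of the number of missing edges then decays like \<open>exp (- p (1 - 1/x) k\<^sup>2/2)\<close>, and \<open>x = 1 + \<epsilon>/2\<close>
  makes it tend to zero.
\<close>

subsection \<open>Random subsets\<close>

definition random_subset :: "'a set \<Rightarrow> real \<Rightarrow> 'a set pmf" where
  "random_subset E p = map_pmf (\<lambda>f. {e \<in> E. f e}) (Pi_pmf E False (\<lambda>_. bernoulli_pmf p))"

lemma binomial_random_graph_eq: "binomial_random_graph V p = random_subset (nsets V 2) p"
  by (simp add: binomial_random_graph_def random_subset_def)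

lemma set_pmf_random_subset: "set_pmf (random_subset E p) \<subseteq> Pow E"
  by (auto simp: random_subset_def)

lemma integrable_random_subset:
  fixes g :: "'a set \<Rightarrow> real"
  assumes "finite E"
  shows "integrable (measure_pmf (random_subset E p)) g"
  using finite_subset[OF set_pmf_random_subset] assms
  by (intro integrable_measure_pmf_finite) auto

lemma pmf_random_subset:
  assumes E: "finite E" and p: "0 \<le> p" "p \<le> 1" and F: "F \<subseteq> E"
  shows "pmf (random_subset E p) F = p ^ card F * (1 - p) ^ (card E - card F)"
proof -
  let ?P = "Pi_pmf E False (\<lambda>_. bernoulli_pmf p)" and ?h = "\<lambda>f. {e \<in> E. f e}"
  have "pmf (random_subset E p) F = measure_pmf.prob ?P (?h -` {F})"
    unfolding random_subset_def by (rule pmf_map)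
  also have "\<dots> = measure_pmf.prob ?P {\<lambda>e. e \<in> F}"
  proof (intro measure_pmf.finite_measure_eq_AE AE_pmfI)
    fix f assume "f \<in> set_pmf ?P"
    then have "\<not> f e" if "e \<notin> E" for e
      using set_Pi_pmf_subset[OF E] that by fastforce
    then show "f \<in> ?h -` {F} \<longleftrightarrow> f \<in> {\<lambda>e. e \<in> F}"
      using F by (auto simp: fun_eq_iff)
  qed auto
  also have "\<dots> = (\<Prod>e\<in>E. pmf (bernoulli_pmf p) (e \<in> F))"
    using F by (subst measure_pmf_single, intro pmf_Pi'[OF E]) auto
  also have "\<dots> = (\<Prod>e\<in>E. if e \<in> F then p else 1 - p)"
    using p by (intro prod.cong) auto
  also have "\<dots> = p ^ card F * (1 - p) ^ card (E - F)"
    using E F by (simp add: prod.If_cases Int_absorb1 Diff_eq)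
  finally show ?thesis
    using E F by (simp add: card_Diff_subset finite_subset)
qed

lemma expectation_random_subset:
  fixes g :: "'a set \<Rightarrow> real"
  assumes "finite E" "0 \<le> p" "p \<le> 1"
  shows "measure_pmf.expectation (random_subset E p) g
    = (\<Sum>F\<in>Pow E. p ^ card F * (1 - p) ^ (card E - card F) * g F)"
proof -
  have "measure_pmf.expectation (random_subset E p) g
    = (\<Sum>F\<in>Pow E. g F * pmf (random_subset E p) F)"
    using assms set_pmf_random_subset by (intro integral_measure_pmf_real) auto
  also have "\<dots> = (\<Sum>F\<in>Pow E. p ^ card F * (1 - p) ^ (card E - card F) * g F)"
    using pmf_random_subset[OF assms] by (intro sum.cong) (auto simp: mult_ac)
  finally show ?thesis .
qed

lemma prob_random_subset_mono:
  assumes "\<And>F. F \<subseteq> E \<Longrightarrow> F \<in> X \<Longrightarrow> F \<in> Y"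
  shows "measure_pmf.prob (random_subset E p) X \<le> measure_pmf.prob (random_subset E p) Y"
proof (intro measure_pmf.finite_measure_mono_AE AE_pmfI impI)
  fix F assume "F \<in> set_pmf (random_subset E p)" "F \<in> X"
  then show "F \<in> Y" using set_pmf_random_subset assms by blast
qed auto

lemma prob_random_subset_le_expectation:
  fixes g :: "'a set \<Rightarrow> real"
  assumes E: "finite E"
    and nonneg: "\<And>F. F \<subseteq> E \<Longrightarrow> 0 \<le> g F"
    and ge_1: "\<And>F. F \<subseteq> E \<Longrightarrow> F \<in> X \<Longrightarrow> 1 \<le> g F"
  shows "measure_pmf.prob (random_subset E p) X \<le> measure_pmf.expectation (random_subset E p) g"
proof -
  have "measure_pmf.expectation (random_subset E p) (indicator X)
    \<le> measure_pmf.expectation (random_subset E p) g"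
    using set_pmf_random_subset nonneg ge_1
    by (intro integral_mono_AE integrable_random_subset E AE_pmfI)
      (force simp: indicator_def)
  then show ?thesis by simp
qed

lemma expectation_power_card_random_subset:
  fixes x :: real
  assumes E: "finite E" and p: "0 \<le> p" "p \<le> 1" and T: "T \<subseteq> E" and x: "0 \<le> x"
  shows "measure_pmf.expectation (random_subset E p) (\<lambda>F. x ^ card (F \<inter> T))
    = (1 + p * (x - 1)) ^ card T"
proof -
  let ?y = "\<lambda>e b. if b \<and> e \<in> T then x else 1"
  have "{e \<in> E. f e} \<inter> T = E \<inter> {e. f e \<and> e \<in> T}" for f
    by auto
  then have "x ^ card ({e \<in> E. f e} \<inter> T) = (\<Prod>e\<in>E. ?y e (f e))" for f
    using E by (simp add: prod.If_cases)
  then have "measure_pmf.expectation (random_subset E p) (\<lambda>F. x ^ card (F \<inter> T))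
    = measure_pmf.expectation (Pi_pmf E False (\<lambda>_. bernoulli_pmf p)) (\<lambda>f. \<Prod>e\<in>E. ?y e (f e))"
    by (simp add: random_subset_def)
  also have "\<dots> = (\<Prod>e\<in>E. measure_pmf.expectation (bernoulli_pmf p) (?y e))"
    using E x by (intro expectation_prod_Pi_pmf) (auto intro!: integrable_measure_pmf_finite)
  also have "\<dots> = (\<Prod>e\<in>E. if e \<in> T then 1 + p * (x - 1) else 1)"
    using p by (intro prod.cong) (auto simp: algebra_simps)
  also have "\<dots> = (1 + p * (x - 1)) ^ card T"
    using E T by (simp add: prod.If_cases Int_absorb1)
  finally show ?thesis .
qed

lemma prob_card_random_subset_ge:
  fixes x :: real
  assumes E: "finite E" and p: "0 \<le> p" "p \<le> 1" and T: "T \<subseteq> E" and x: "1 \<le> x"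
  shows "measure_pmf.prob (random_subset E p) {F. k \<le> card (F \<inter> T)}
    \<le> exp (p * card T * (x - 1)) / x ^ k"
proof -
  have "measure_pmf.prob (random_subset E p) {F. k \<le> card (F \<inter> T)}
    \<le> measure_pmf.expectation (random_subset E p) (\<lambda>F. x ^ card (F \<inter> T) / x ^ k)"
    using x by (intro prob_random_subset_le_expectation E) (auto intro: power_increasing)
  also have "\<dots> = (1 + p * (x - 1)) ^ card T / x ^ k"
    using expectation_power_card_random_subset[OF E p T] x by simp
  also have "\<dots> \<le> exp (p * (x - 1)) ^ card T / x ^ k"
    using p x by (intro divide_right_mono power_mono) auto
  also have "exp (p * (x - 1)) ^ card T = exp (p * card T * (x - 1))"
    by (simp add: exp_of_nat_mult[symmetric] mult_ac)
  finally show ?thesis .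
qed

subsection \<open>Set functions that decay under random insertions\<close>

lemma sum_nsets_Suc:
  fixes g :: "'a set \<Rightarrow> 'b::comm_semiring_1"
  assumes E: "finite E"
  shows "of_nat (Suc j) * (\<Sum>F\<in>nsets E (Suc j). g F) = (\<Sum>F\<in>nsets E j. \<Sum>e\<in>E - F. g (insert e F))"
proof -
  have fin: "finite (nsets E i)" for i
    using E by (rule finite_imp_finite_nsets)
  have "of_nat (Suc j) * (\<Sum>F\<in>nsets E (Suc j). g F) = (\<Sum>F\<in>nsets E (Suc j). \<Sum>e\<in>F. g F)"
    unfolding sum_distrib_left by (intro sum.cong) (auto simp: nsets_def)
  also have "\<dots> = (\<Sum>(F, e)\<in>Sigma (nsets E (Suc j)) (\<lambda>F. F). g F)"
    using fin by (intro sum.Sigma) (auto simp: nsets_def)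
  also have "\<dots> = (\<Sum>(F, e)\<in>Sigma (nsets E j) (\<lambda>F. E - F). g (insert e F))"
    by (rule sum.reindex_bij_witness[of _ "\<lambda>(F, e). (insert e F, e)" "\<lambda>(F, e). (F - {e}, e)"])
      (auto simp: nsets_def insert_absorb)
  also have "\<dots> = (\<Sum>F\<in>nsets E j. \<Sum>e\<in>E - F. g (insert e F))"
    using fin E by (intro sum.Sigma[symmetric]) auto
  finally show ?thesis .
qed

locale decaying_set_function =
  fixes E :: "'a set" and g :: "'a set \<Rightarrow> real" and c :: real
  assumes finite_ground: "finite E"
    and rate: "0 \<le> c" "c \<le> card E"
    and nonneg: "\<And>F. F \<subseteq> E \<Longrightarrow> 0 \<le> g F"
    and decay: "\<And>F. F \<subseteq> E \<Longrightarrow> (\<Sum>e\<in>E. g (insert e F)) \<le> (card E - c) * g F"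
begin

lemma sum_insert_new_le:
  assumes F: "F \<subseteq> E"
  shows "(\<Sum>e\<in>E - F. g (insert e F)) \<le> real (card E - card F) * (1 - c / card E) * g F"
proof -
  have "(\<Sum>e\<in>F. g (insert e F)) = card F * g F"
    by (simp add: insert_absorb)
  then have "(\<Sum>e\<in>E - F. g (insert e F)) \<le> (card E - c - card F) * g F"
    using decay[OF F] sum.subset_diff[OF F finite_ground, of "\<lambda>e. g (insert e F)"]
    by (simp add: algebra_simps)
  also have "\<dots> \<le> real (card E - card F) * (1 - c / card E) * g F"
  proof (rule mult_right_mono[OF _ nonneg[OF F]])
    have "c * ((real (card E) - card F) / card E) \<le> c * 1"
      using rate by (intro mult_left_mono) (auto simp: divide_le_eq_1)
    also have "c * ((real (card E) - card F) / card E) = (real (card E) - card F) * (c / card E)"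
      by simp
    finally show "card E - c - card F \<le> real (card E - card F) * (1 - c / card E)"
      using card_mono[OF finite_ground F] by (simp only: of_nat_diff right_diff_distrib) simp
  qed
  finally show ?thesis .
qed

lemma sum_nsets_le: "(\<Sum>F\<in>nsets E j. g F) \<le> (card E choose j) * (1 - c / card E) ^ j * g {}"
proof (induction j)
  case 0
  then show ?case by simp
next
  case (Suc j)
  let ?N = "card E" and ?r = "1 - c / card E"
  have r: "0 \<le> ?r"
    using rate by (auto simp: divide_le_eq_1)
  have "real (Suc j) * (\<Sum>F\<in>nsets E (Suc j). g F) = (\<Sum>F\<in>nsets E j. \<Sum>e\<in>E - F. g (insert e F))"
    by (rule sum_nsets_Suc[OF finite_ground])
  also have "\<dots> \<le> (\<Sum>F\<in>nsets E j. real (?N - j) * ?r * g F)"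
    using sum_insert_new_le by (intro sum_mono) (auto simp: nsets_def)
  also have "\<dots> = real (?N - j) * ?r * (\<Sum>F\<in>nsets E j. g F)"
    by (simp only: sum_distrib_left)
  also have "\<dots> \<le> real (?N - j) * ?r * ((?N choose j) * ?r ^ j * g {})"
    using Suc.IH r by (intro mult_left_mono) auto
  also have "\<dots> = real ((?N - j) * (?N choose j)) * ?r ^ Suc j * g {}"
    by (simp add: mult_ac)
  also have "(?N - j) * (?N choose j) = Suc j * (?N choose Suc j)"
    by (simp only: binomial_absorb_comp binomial_absorption)
  also have "real (Suc j * (?N choose Suc j)) * ?r ^ Suc j * g {}
    = real (Suc j) * ((?N choose Suc j) * ?r ^ Suc j * g {})"
    by (simp only: of_nat_mult mult.assoc)
  finally show ?case by (simp del: of_nat_Suc)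
qed

lemma expectation_random_subset_le:
  assumes p: "0 \<le> p" "p \<le> 1"
  shows "measure_pmf.expectation (random_subset E p) g \<le> exp (- (p * c)) * g {}"
proof -
  let ?N = "card E" and ?r = "1 - c / card E"
  have "measure_pmf.expectation (random_subset E p) g
    = (\<Sum>F\<in>Pow E. p ^ card F * (1 - p) ^ (?N - card F) * g F)"
    by (rule expectation_random_subset[OF finite_ground p])
  also have "\<dots> = (\<Sum>j\<le>?N. \<Sum>F\<in>{F \<in> Pow E. card F = j}. p ^ card F * (1 - p) ^ (?N - card F) * g F)"
    using finite_ground by (intro sum.group[symmetric]) (auto intro: card_mono)
  also have "\<dots> = (\<Sum>j\<le>?N. p ^ j * (1 - p) ^ (?N - j) * (\<Sum>F\<in>nsets E j. g F))"
    unfolding sum_distrib_left using finite_subset[OF _ finite_ground]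
    by (intro sum.cong) (auto simp: nsets_def)
  also have "\<dots> \<le> (\<Sum>j\<le>?N. p ^ j * (1 - p) ^ (?N - j) * ((?N choose j) * ?r ^ j * g {}))"
    using p by (intro sum_mono mult_left_mono sum_nsets_le) auto
  also have "\<dots> = (\<Sum>j\<le>?N. (?N choose j) * (p * ?r) ^ j * (1 - p) ^ (?N - j)) * g {}"
    unfolding sum_distrib_right by (intro sum.cong) (auto simp: power_mult_distrib)
  also have "(\<Sum>j\<le>?N. (?N choose j) * (p * ?r) ^ j * (1 - p) ^ (?N - j)) = (1 - p * c / ?N) ^ ?N"
    unfolding binomial_ring[symmetric] by (simp add: algebra_simps)
  also have "(1 - p * c / ?N) ^ ?N * g {} \<le> exp (- (p * c)) * g {}"
  proof (rule mult_right_mono)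
    show "(1 - p * c / ?N) ^ ?N \<le> exp (- (p * c))"
    proof (cases "?N = 0")
      case True
      then show ?thesis using rate by simp
    next
      case False
      have "p * c \<le> 1 * real ?N" using p rate by (intro mult_mono) auto
      then show ?thesis using False exp_ge_one_minus_x_over_n_power_n[of "p * c" ?N] by simp
    qed
  qed (simp add: nonneg)
  finally show ?thesis .
qed

end

locale decreasing_deficit =
  fixes E :: "'a set" and D :: "'a set \<Rightarrow> nat" and m x :: real
  assumes finite_ground: "finite E"
    and antimono: "antimono_on (Pow E) D"
    and many_drops: "\<And>F. F \<subseteq> E \<Longrightarrow> 0 < D F \<Longrightarrow> m \<le> card {e \<in> E. D (insert e F) < D F}"
    and m: "0 \<le> m" and x: "1 \<le> x"
begin

text \<open>With the value \<open>x ^ 0 = 1\<close> at deficit \<open>0\<close> the potential would stop decaying there.\<close>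

definition potential :: "'a set \<Rightarrow> real" where
  "potential F = (if D F = 0 then 0 else x ^ D F)"

lemma potential_nonneg: "0 \<le> potential F"
  using x by (simp add: potential_def)

lemma insert_deficit_le:
  assumes "F \<subseteq> E" "e \<in> E"
  shows "D (insert e F) \<le> D F"
  using monotone_onD[OF antimono, of F "insert e F"] assms by auto

lemma potential_insert_le:
  assumes "F \<subseteq> E" "e \<in> E"
  shows "potential (insert e F) \<le> potential F"
  using insert_deficit_le[OF assms] x by (auto simp: potential_def intro: power_increasing)

lemma potential_insert_drop_le:
  assumes drop: "D (insert e F) < D F"
  shows "potential (insert e F) \<le> potential F / x"
proof -
  have "potential (insert e F) \<le> x ^ (D F - 1)"
    using drop x by (auto simp: potential_def intro: power_increasing)
  also have "\<dots> = potential F / x"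
    using drop x by (cases "D F") (auto simp: potential_def)
  finally show ?thesis .
qed

lemma sum_potential_insert_le:
  assumes F: "F \<subseteq> E"
  shows "(\<Sum>e\<in>E. potential (insert e F)) \<le> (card E - m * (1 - 1 / x)) * potential F"
proof (cases "D F = 0")
  case True
  then have "D (insert e F) = 0" if "e \<in> E" for e
    using insert_deficit_le[OF F that] by simp
  then show ?thesis using True by (simp add: potential_def)
next
  case False
  let ?drops = "{e \<in> E. D (insert e F) < D F}"
  have "(\<Sum>e\<in>E. potential (insert e F))
    = (\<Sum>e\<in>E - ?drops. potential (insert e F)) + (\<Sum>e\<in>?drops. potential (insert e F))"
    using finite_ground by (intro sum.subset_diff) auto
  also have "\<dots> \<le> (\<Sum>e\<in>E - ?drops. potential F) + (\<Sum>e\<in>?drops. potential F / x)"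
    using potential_insert_le[OF F] potential_insert_drop_le by (intro add_mono sum_mono) auto
  also have "\<dots> = (card E - card ?drops * (1 - 1 / x)) * potential F"
    using finite_ground card_mono[OF finite_ground, of ?drops]
    by (simp add: card_Diff_subset of_nat_diff algebra_simps)
  also have "\<dots> \<le> (card E - m * (1 - 1 / x)) * potential F"
    using many_drops[OF F] False x potential_nonneg
    by (intro mult_right_mono diff_left_mono) auto
  finally show ?thesis .
qed

lemma prob_deficit_pos_le:
  assumes p: "0 \<le> p" "p \<le> 1"
  shows "measure_pmf.prob (random_subset E p) {F. 0 < D F} \<le> exp (- (p * m * (1 - 1 / x))) * x ^ D {}"
proof (cases "D {} = 0")
  case True
  then have "D F = 0" if "F \<subseteq> E" for F
    using monotone_onD[OF antimono, of "{}" F] that by simp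
  then have "measure_pmf.prob (random_subset E p) {F. 0 < D F} \<le> measure_pmf.prob (random_subset E p) {}"
    by (intro prob_random_subset_mono) simp
  also have "\<dots> \<le> exp (- (p * m * (1 - 1 / x))) * x ^ D {}"
    using x by simp
  finally show ?thesis .
next
  case False
  have "m * (1 - 1 / x) \<le> m * 1"
    using m x by (intro mult_left_mono) auto
  also have "m \<le> card {e \<in> E. D (insert e {}) < D {}}"
    using many_drops[of "{}"] False by simp
  also have "\<dots> \<le> real (card E)"
    using finite_ground by (intro of_nat_mono card_mono) auto
  finally have "m * (1 - 1 / x) \<le> card E" by simp
  then interpret decaying_set_function E potential "m * (1 - 1 / x)"
    using finite_ground m x potential_nonneg sum_potential_insert_le by unfold_locales auto
  have "measure_pmf.prob (random_subset E p) {F. 0 < D F}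
    \<le> measure_pmf.expectation (random_subset E p) potential"
    using x by (intro prob_random_subset_le_expectation finite_ground potential_nonneg)
      (auto simp: potential_def)
  also have "\<dots> \<le> exp (- (p * m * (1 - 1 / x))) * potential {}"
    using expectation_random_subset_le[OF p] by (simp only: mult.assoc)
  also have "potential {} = x ^ D {}"
    using False by (simp add: potential_def)
  finally show ?thesis .
qed

end

subsection \<open>Matchings and rotations\<close>

definition matching :: "'a set set \<Rightarrow> 'a set set \<Rightarrow> bool" where
  "matching E M \<longleftrightarrow> M \<subseteq> E \<and> disjoint M"

definition matching_number :: "'a set set \<Rightarrow> nat" where
  "matching_number E = Max (card ` {M. matching E M})"

definition matching_deficit :: "'a set \<Rightarrow> 'a set set \<Rightarrow> nat" where
  "matching_deficit V E = card V div 2 - matching_number E"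

definition maximum_matching :: "'a set set \<Rightarrow> 'a set set \<Rightarrow> bool" where
  "maximum_matching E M \<longleftrightarrow> matching E M \<and> card M = matching_number E"

definition neighbours :: "'a set set \<Rightarrow> 'a \<Rightarrow> 'a set" where
  "neighbours E w = {x. {w, x} \<in> E}"

definition rotations :: "'a set set \<Rightarrow> 'a set set \<Rightarrow> 'a \<Rightarrow> 'a set" where
  "rotations E M w = {y. \<exists>x\<in>neighbours E w. {x, y} \<in> M}"

definition augmenting_pairs :: "'a set \<Rightarrow> 'a set set \<Rightarrow> 'a set set" where
  "augmenting_pairs V E = {e \<in> nsets V 2. matching_number E < matching_number (insert e E)}"

lemma matching_mono: "matching E M \<Longrightarrow> E \<subseteq> E' \<Longrightarrow> matching E' M"
  by (auto simp: matching_def)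

lemma matching_insert:
  assumes "matching E M" "e \<in> E" "e \<inter> \<Union>M = {}"
  shows "matching E (insert e M)"
  using assms by (auto simp: matching_def pairwise_insert disjnt_def)

lemma matching_remove: "matching E M \<Longrightarrow> matching E (M - N)"
  by (auto simp: matching_def pairwise_def)

lemma matching_edge_unique:
  assumes "matching E M" "e \<in> M" "f \<in> M" "v \<in> e" "v \<in> f"
  shows "e = f"
  using assms by (auto simp: matching_def pairwise_def disjnt_def)

lemma maximum_matching_imp_matching: "maximum_matching E M \<Longrightarrow> matching E M"
  by (simp add: maximum_matching_def)

locale finite_simple_graph =
  fixes V :: "'a set" and E :: "'a set set"
  assumes finite_vertices: "finite V" and simple: "simple_graph V E"
begin

lemma edges_subset: "E \<subseteq> nsets V 2"
  using simple by (simp add: simple_graph_def)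

lemma finite_simple_graph_Un:
  assumes "F \<subseteq> nsets V 2"
  shows "finite_simple_graph V (E \<union> F)"
  using assms finite_vertices edges_subset by (simp add: finite_simple_graph_def simple_graph_def)

lemma finite_edges: "finite E"
  using edges_subset finite_vertices finite_imp_finite_nsets finite_subset by metis

lemma card_neighbours: "card (neighbours E w) = degree E w"
proof -
  have "bij_betw (\<lambda>x. {w, x}) (neighbours E w) {e \<in> E. w \<in> e}"
    unfolding bij_betw_def
  proof
    show "inj_on (\<lambda>x. {w, x}) (neighbours E w)"
      by (auto simp: inj_on_def doubleton_eq_iff)
    have "e \<in> (\<lambda>x. {w, x}) ` neighbours E w" if e: "e \<in> E" "w \<in> e" for e
    proof -
      obtain u v where "e = {u, v}" using nsets2_E e(1) edges_subset by blast
      then show ?thesis using e by (auto simp: neighbours_def insert_commute)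
    qed
    then show "(\<lambda>x. {w, x}) ` neighbours E w = {e \<in> E. w \<in> e}"
      by (auto simp: neighbours_def)
  qed
  then show ?thesis
    unfolding degree_def by (rule bij_betw_same_card)
qed

lemma sum_degree: "(\<Sum>v\<in>V. degree E v) = 2 * card E"
  unfolding degree_def
proof (rule sum_multicount[OF finite_vertices finite_edges], rule ballI)
  fix e assume "e \<in> E"
  then have "{v \<in> V. v \<in> e} = e" "card e = 2"
    using edges_subset by (auto simp: nsets_def)
  then show "card {v \<in> V. v \<in> e} = 2" by simp
qed

lemma degree_mono: "F \<subseteq> E \<Longrightarrow> degree F v \<le> degree E v"
  unfolding degree_def using finite_edges by (intro card_mono) auto

lemma finite_matching: "matching E M \<Longrightarrow> finite M"
  using finite_subset[OF _ finite_edges] by (auto simp: matching_def)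

lemma matching_subset_nsets: "matching E M \<Longrightarrow> M \<subseteq> nsets V 2"
  using edges_subset by (auto simp: matching_def)

lemma Union_matching_subset: "matching E M \<Longrightarrow> \<Union>M \<subseteq> V"
  using matching_subset_nsets by (fastforce simp: nsets_def)

lemma card_Union_matching:
  assumes "matching E M"
  shows "card (\<Union>M) = 2 * card M"
proof -
  have edge: "finite e \<and> card e = 2" if "e \<in> M" for e
    using that matching_subset_nsets[OF assms] by (auto simp: nsets_def)
  then have "card (\<Union>M) = sum card M"
    using assms by (intro card_Union_disjoint) (auto simp: matching_def)
  then show ?thesis using edge by simp
qed

lemma finite_Union_matching: "matching E M \<Longrightarrow> finite (\<Union>M)"
  by (rule finite_subset[OF Union_matching_subset finite_vertices])

lemma card_matching_le:
  assumes "matching E M"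
  shows "2 * card M \<le> card V"
  using card_mono[OF finite_vertices Union_matching_subset[OF assms]]
  by (simp add: card_Union_matching[OF assms])

lemma finite_matchings: "finite {M. matching E M}"
  by (rule finite_subset[of _ "Pow E"]) (auto simp: matching_def finite_edges)

lemma card_le_matching_number: "matching E M \<Longrightarrow> card M \<le> matching_number E"
  unfolding matching_number_def using finite_matchings by (intro Max_ge) auto

lemma maximum_matching_exists: obtains M where "maximum_matching E M"
proof -
  have "matching E {}" by (simp add: matching_def)
  then have "matching_number E \<in> card ` {M. matching E M}"
    unfolding matching_number_def using finite_matchings by (intro Max_in) auto
  then show ?thesis using that by (auto simp: maximum_matching_def)
qed

lemma matching_number_mono:
  assumes "F \<subseteq> E"
  shows "matching_number F \<le> matching_number E"
proof -
  interpret F: finite_simple_graph V F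
    using finite_vertices edges_subset assms by unfold_locales (auto simp: simple_graph_def)
  obtain M where "maximum_matching F M" using F.maximum_matching_exists .
  then show ?thesis
    using card_le_matching_number matching_mono[OF _ assms] by (metis maximum_matching_def)
qed

lemma matching_deficit_antimono: "F \<subseteq> E \<Longrightarrow> matching_deficit V E \<le> matching_deficit V F"
  using matching_number_mono by (simp add: matching_deficit_def diff_le_mono2)

lemma has_perfect_matching_iff:
  assumes "even (card V)"
  shows "has_perfect_matching V E \<longleftrightarrow> matching_deficit V E = 0"
proof
  assume "has_perfect_matching V E"
  then obtain M where "matching E M" "2 * card M = card V"
    by (auto simp: has_perfect_matching_def perfect_matching_def matching_def)
  then show "matching_deficit V E = 0"
    using card_le_matching_number by (fastforce simp: matching_deficit_def)
next
  assume "matching_deficit V E = 0"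
  then have large: "card V div 2 \<le> matching_number E"
    by (simp add: matching_deficit_def)
  obtain M where M: "maximum_matching E M" using maximum_matching_exists .
  then have "2 * card M = card V"
    using large card_matching_le[OF maximum_matching_imp_matching[OF M]] assms
    by (auto simp: maximum_matching_def)
  then have "perfect_matching V E M"
    using M by (simp add: perfect_matching_def maximum_matching_def matching_def)
  then show "has_perfect_matching V E"
    unfolding has_perfect_matching_def by blast
qed

lemma neighbours_covered:
  assumes M: "maximum_matching E M" and w: "w \<notin> \<Union>M"
  shows "neighbours E w \<subseteq> \<Union>M"
proof
  fix x assume "x \<in> neighbours E w"
  then have wx: "{w, x} \<in> E" by (simp add: neighbours_def)
  show "x \<in> \<Union>M"
  proof (rule ccontr)
    assume "x \<notin> \<Union>M"
    then have "matching E (insert {w, x} M)"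
      using matching_insert[OF maximum_matching_imp_matching[OF M] wx] w by auto
    moreover have "{w, x} \<notin> M" using w by blast
    ultimately show False
      using card_le_matching_number M finite_matching[OF maximum_matching_imp_matching[OF M]]
      by (fastforce simp: maximum_matching_def)
  qed
qed

lemma rotations_covered: "rotations E M w \<subseteq> \<Union>M"
  by (auto simp: rotations_def)

lemma card_rotations:
  assumes M: "maximum_matching E M" and w: "w \<notin> \<Union>M"
  shows "card (rotations E M w) = degree E w"
proof -
  note matching = maximum_matching_imp_matching[OF M]
  have "\<exists>y. {x, y} \<in> M" if x: "x \<in> neighbours E w" for x
  proof -
    obtain e where e: "e \<in> M" "x \<in> e"
      using neighbours_covered[OF M w] x by blast
    then have "e \<in> nsets V 2"
      using matching_subset_nsets[OF matching] by blast
    then obtain u v where "e = {u, v}" by (rule nsets2_E)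
    then show ?thesis using e by (auto simp: insert_commute)
  qed
  then obtain partner where partner: "\<And>x. x \<in> neighbours E w \<Longrightarrow> {x, partner x} \<in> M"
    by metis
  have doubleton: "x \<noteq> y" if "{x, y} \<in> M" for x y
    using subsetD[OF matching_subset_nsets[OF matching] that] by simp
  have partner_eq: "y = partner x" if "x \<in> neighbours E w" "{x, y} \<in> M" for x y
    using matching_edge_unique[OF matching that(2) partner[OF that(1)], of x]
    by (auto simp: doubleton_eq_iff)
  have "inj_on partner (neighbours E w)"
  proof (rule inj_onI)
    fix x x' assume x: "x \<in> neighbours E w" "x' \<in> neighbours E w" "partner x = partner x'"
    then have "{x, partner x} = {x', partner x'}"
      using matching_edge_unique[OF matching partner partner] by blast
    then show "x = x'"
      using x doubleton partner by (auto simp: doubleton_eq_iff)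
  qed
  moreover have "rotations E M w = partner ` neighbours E w"
    using partner partner_eq by (auto simp: rotations_def)
  ultimately show ?thesis
    by (simp add: card_image card_neighbours)
qed

lemma maximum_matching_rotate:
  assumes M: "maximum_matching E M" and w: "w \<notin> \<Union>M" and y: "y \<in> rotations E M w"
  obtains M' where "maximum_matching E M'" "\<Union>M' = insert w (\<Union>M) - {y}"
proof -
  note matching = maximum_matching_imp_matching[OF M]
  obtain x where wx: "{w, x} \<in> E" and xy: "{x, y} \<in> M"
    using y by (auto simp: rotations_def neighbours_def)
  have "x \<noteq> y"
    using subsetD[OF matching_subset_nsets[OF matching] xy] by simp
  have rest: "\<Union>(M - {{x, y}}) = \<Union>M - {x, y}"
    using matching_edge_unique[OF matching _ xy] xy by auto
  let ?M' = "insert {w, x} (M - {{x, y}})"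
  have "matching E ?M'"
    using rest w by (intro matching_insert matching_remove matching wx) auto
  moreover have "card ?M' = card M"
    using w finite_matching[OF matching] card_Suc_Diff1[OF finite_matching[OF matching] xy]
    by (subst card_insert_disjoint) auto
  ultimately have "maximum_matching E ?M'"
    using M by (simp add: maximum_matching_def)
  moreover have "\<Union>?M' = insert w (\<Union>M) - {y}"
  proof -
    have "x \<in> \<Union>M" "y \<in> \<Union>M" using xy by blast+
    then show ?thesis
      unfolding Union_insert rest using w \<open>x \<noteq> y\<close> by blast
  qed
  ultimately show ?thesis by (rule that)
qed

lemma uncovered_pair_exists:
  assumes "even (card V)" "0 < matching_deficit V E" and M: "maximum_matching E M"
  obtains a b where "a \<in> V" "b \<in> V" "a \<noteq> b" "a \<notin> \<Union>M" "b \<notin> \<Union>M"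
proof -
  note matching = maximum_matching_imp_matching[OF M]
  have "card (V - \<Union>M) = card V - 2 * matching_number E"
    using card_Union_matching[OF matching] Union_matching_subset[OF matching]
      finite_Union_matching[OF matching] M by (simp add: card_Diff_subset maximum_matching_def)
  then have "2 \<le> card (V - \<Union>M)" using assms(1,2) by (auto simp: matching_deficit_def)
  then obtain T where "T \<subseteq> V - \<Union>M" "card T = 2" by (meson obtain_subset_with_card_n)
  then show ?thesis using that by (auto simp: card_2_iff)
qed

lemma matching_deficit_le:
  assumes even: "even (card V)" and deg: "\<And>v. v \<in> V \<Longrightarrow> k \<le> degree E v"
  shows "matching_deficit V E \<le> card V div 2 - k"
proof (cases "0 < matching_deficit V E")
  case True
  obtain M where M: "maximum_matching E M" using maximum_matching_exists .
  note matching = maximum_matching_imp_matching[OF M]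
  obtain a b where ab: "a \<in> V" "b \<in> V" "a \<noteq> b" "a \<notin> \<Union>M" "b \<notin> \<Union>M"
    using uncovered_pair_exists[OF even True M] .
  have "y \<notin> neighbours E b" if y: "y \<in> rotations E M a" for y
  proof -
    obtain M' where M': "maximum_matching E M'" "\<Union>M' = insert a (\<Union>M) - {y}"
      using maximum_matching_rotate[OF M ab(4) y] .
    then have "b \<notin> \<Union>M'" using ab by auto
    then show ?thesis using neighbours_covered[OF M'(1)] M'(2) by blast
  qed
  then have disj: "rotations E M a \<inter> neighbours E b = {}" by auto
  have covered: "rotations E M a \<union> neighbours E b \<subseteq> \<Union>M"
    using rotations_covered neighbours_covered[OF M ab(5)] by blast
  have "2 * k \<le> card (rotations E M a) + card (neighbours E b)"
    using card_rotations[OF M ab(4)] card_neighbours deg[OF ab(1)] deg[OF ab(2)] by simp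
  also have "\<dots> = card (rotations E M a \<union> neighbours E b)"
    using disj finite_subset[OF covered finite_Union_matching[OF matching]]
    by (simp add: card_Un_disjoint)
  also have "\<dots> \<le> card (\<Union>M)"
    using covered finite_Union_matching[OF matching] by (intro card_mono)
  also have "\<dots> = 2 * matching_number E"
    using card_Union_matching[OF matching] M by (simp add: maximum_matching_def)
  finally show ?thesis by (simp add: matching_deficit_def)
qed simp

lemma uncovered_pair_augmenting:
  assumes M: "maximum_matching E M"
    and uv: "u \<in> V" "v \<in> V" "u \<noteq> v" "u \<notin> \<Union>M" "v \<notin> \<Union>M"
  shows "{u, v} \<in> augmenting_pairs V E"
proof -
  interpret with_edge: finite_simple_graph V "insert {u, v} E"
    using finite_simple_graph_Un[of "{{u, v}}"] uv(1-3) by simp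
  note matching = maximum_matching_imp_matching[OF M]
  have "matching (insert {u, v} E) M"
    using matching by (rule matching_mono) auto
  then have "matching (insert {u, v} E) (insert {u, v} M)"
    using uv(4,5) by (intro matching_insert) auto
  moreover have "{u, v} \<notin> M" using uv by blast
  ultimately have "matching_number E < matching_number (insert {u, v} E)"
    using with_edge.card_le_matching_number M finite_matching[OF matching]
    by (fastforce simp: maximum_matching_def)
  then show ?thesis using uv by (simp add: augmenting_pairs_def)
qed

lemma finite_simple_graph_augmenting_pairs: "finite_simple_graph V (augmenting_pairs V E)"
  using finite_vertices by unfold_locales (auto simp: simple_graph_def augmenting_pairs_def)

lemma degree_augmenting_pairs_ge:
  assumes M: "maximum_matching E M"
    and ab: "a \<in> V" "b \<in> V" "a \<noteq> b" "a \<notin> \<Union>M" "b \<notin> \<Union>M"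
    and u: "u \<in> rotations E M a"
  shows "degree E b \<le> degree (augmenting_pairs V E) u"
proof -
  interpret aug: finite_simple_graph V "augmenting_pairs V E"
    by (rule finite_simple_graph_augmenting_pairs)
  obtain M' where M': "maximum_matching E M'" "\<Union>M' = insert a (\<Union>M) - {u}"
    using maximum_matching_rotate[OF M ab(4) u] .
  have b: "b \<notin> \<Union>M'" using M'(2) ab by auto
  have covered: "u \<in> \<Union>M" using rotations_covered u by blast
  have "v \<in> neighbours (augmenting_pairs V E) u" if v: "v \<in> rotations E M' b" for v
  proof -
    obtain M'' where M'': "maximum_matching E M''" "\<Union>M'' = insert b (\<Union>M') - {v}"
      using maximum_matching_rotate[OF M'(1) b v] .
    have v_covered: "v \<in> \<Union>M'" using rotations_covered v by blast
    have "{u, v} \<in> augmenting_pairs V E"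
    proof (rule uncovered_pair_augmenting[OF M''(1)])
      show "u \<in> V" "v \<in> V"
        using covered v_covered M M'(1) Union_matching_subset maximum_matching_imp_matching by blast+
    qed (use covered v_covered ab M'(2) M''(2) in auto)
    then show ?thesis by (simp add: neighbours_def)
  qed
  moreover have "finite (neighbours (augmenting_pairs V E) u)"
    by (rule finite_subset[OF _ finite_vertices])
      (auto simp: neighbours_def augmenting_pairs_def)
  ultimately have "card (rotations E M' b) \<le> card (neighbours (augmenting_pairs V E) u)"
    by (intro card_mono) auto
  then show ?thesis
    using card_rotations[OF M'(1) b] aug.card_neighbours by simp
qed

lemma augmenting_pairs_eq:
  assumes "0 < matching_deficit V E"
  shows "augmenting_pairs V E
    = {e \<in> nsets V 2. matching_deficit V (insert e E) < matching_deficit V E}"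
  using assms by (auto simp: augmenting_pairs_def matching_deficit_def)

lemma card_augmenting_pairs_ge:
  assumes even: "even (card V)" and deficient: "0 < matching_deficit V E"
    and deg: "\<And>v. v \<in> V \<Longrightarrow> k \<le> degree E v"
  shows "k\<^sup>2 \<le> 2 * card (augmenting_pairs V E)"
proof -
  interpret aug: finite_simple_graph V "augmenting_pairs V E"
    by (rule finite_simple_graph_augmenting_pairs)
  obtain M where M: "maximum_matching E M" using maximum_matching_exists .
  obtain a b where ab: "a \<in> V" "b \<in> V" "a \<noteq> b" "a \<notin> \<Union>M" "b \<notin> \<Union>M"
    using uncovered_pair_exists[OF even deficient M] .
  have "k\<^sup>2 \<le> card (rotations E M a) * k"
    using card_rotations[OF M ab(4)] deg[OF ab(1)] by (simp add: power2_eq_square)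
  also have "\<dots> \<le> (\<Sum>u\<in>rotations E M a. degree (augmenting_pairs V E) u)"
    using degree_augmenting_pairs_ge[OF M ab] deg[OF ab(2)]
    by (intro sum_bounded_below[where 'a = nat, simplified]) (meson order_trans)
  also have "\<dots> \<le> (\<Sum>u\<in>V. degree (augmenting_pairs V E) u)"
    using finite_vertices rotations_covered Union_matching_subset[OF maximum_matching_imp_matching[OF M]]
    by (intro sum_mono2) blast+
  also have "\<dots> = 2 * card (augmenting_pairs V E)"
    by (rule aug.sum_degree)
  finally show ?thesis .
qed

end

subsection \<open>Perfect matchings in randomly perturbed graphs\<close>

context finite_simple_graph
begin

lemma decreasing_matching_deficit:
  assumes even: "even (card V)" and deg: "\<And>v. v \<in> V \<Longrightarrow> k \<le> degree E v" and x: "1 \<le> x"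
  shows "decreasing_deficit (nsets V 2) (\<lambda>F. matching_deficit V (E \<union> F)) ((real k)\<^sup>2 / 2) x"
proof
  let ?D = "\<lambda>F. matching_deficit V (E \<union> F)"
  show "finite (nsets V 2)"
    using finite_vertices by (rule finite_imp_finite_nsets)
  show "antimono_on (Pow (nsets V 2)) ?D"
    by (intro monotone_onI finite_simple_graph.matching_deficit_antimono[OF finite_simple_graph_Un]) auto
  fix F assume F: "F \<subseteq> nsets V 2" "0 < ?D F"
  interpret EF: finite_simple_graph V "E \<union> F"
    by (rule finite_simple_graph_Un[OF F(1)])
  have "k\<^sup>2 \<le> 2 * card (augmenting_pairs V (E \<union> F))"
    using F(2) even deg EF.degree_mono[of E]
    by (intro EF.card_augmenting_pairs_ge) (auto intro: order_trans)
  then have "k\<^sup>2 \<le> 2 * card {e \<in> nsets V 2. ?D (insert e F) < ?D F}"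
    by (simp add: EF.augmenting_pairs_eq[OF F(2)])
  then have "real (k\<^sup>2) \<le> real (2 * card {e \<in> nsets V 2. ?D (insert e F) < ?D F})"
    by (rule of_nat_mono)
  then show "(real k)\<^sup>2 / 2 \<le> card {e \<in> nsets V 2. ?D (insert e F) < ?D F}"
    by simp
qed (use x in auto)

lemma prob_no_perfect_matching_le:
  assumes even: "even (card V)" and deg: "\<And>v. v \<in> V \<Longrightarrow> k \<le> degree E v"
    and p: "0 \<le> p" "p \<le> 1" and x: "1 \<le> x"
  shows "measure_pmf.prob (binomial_random_graph V p) {G. \<not> has_perfect_matching V (E \<union> G)}
    \<le> exp (- (p * ((real k)\<^sup>2 / 2) * (1 - 1 / x))) * x ^ (card V div 2 - k)"
proof -
  interpret decreasing_deficit "nsets V 2" "\<lambda>F. matching_deficit V (E \<union> F)" "(real k)\<^sup>2 / 2" x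
    using even deg x by (rule decreasing_matching_deficit)
  have "measure_pmf.prob (binomial_random_graph V p) {G. \<not> has_perfect_matching V (E \<union> G)}
    \<le> measure_pmf.prob (random_subset (nsets V 2) p) {G. 0 < matching_deficit V (E \<union> G)}"
    unfolding binomial_random_graph_eq
    using finite_simple_graph.has_perfect_matching_iff[OF finite_simple_graph_Un even]
    by (intro prob_random_subset_mono) auto
  also have "\<dots> \<le> exp (- (p * ((real k)\<^sup>2 / 2) * (1 - 1 / x))) * x ^ matching_deficit V (E \<union> {})"
    by (rule prob_deficit_pos_le[OF p])
  also have "\<dots> \<le> exp (- (p * ((real k)\<^sup>2 / 2) * (1 - 1 / x))) * x ^ (card V div 2 - k)"
    using matching_deficit_le[OF even deg] x by (intro mult_left_mono power_increasing) auto
  finally show ?thesis .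
qed

lemma card_covered_le:
  assumes M: "matching E M" and A: "A \<subseteq> \<Union>M"
  shows "card A \<le> card M + card (M \<inter> nsets A 2)"
proof -
  have edge: "card (e \<inter> A) \<le> 1 + of_bool (e \<in> nsets A 2)" if "e \<in> M" for e
  proof -
    have e: "card e = 2" "finite e"
      using that matching_subset_nsets[OF M] by (auto simp: nsets_def)
    show ?thesis
    proof (cases "e \<subseteq> A")
      case True
      then show ?thesis using e by (simp add: nsets_def Int_absorb2)
    next
      case False
      then have "card (e \<inter> A) < card e" using e by (intro psubset_card_mono) auto
      then show ?thesis using e by simp
    qed
  qed
  have "A = (\<Union>e\<in>M. e \<inter> A)" using A by auto
  then have "card A = card (\<Union>e\<in>M. e \<inter> A)" by simp
  also have "\<dots> \<le> (\<Sum>e\<in>M. card (e \<inter> A))"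
    by (rule card_UN_le[OF finite_matching[OF M]])
  also have "\<dots> \<le> (\<Sum>e\<in>M. 1 + of_bool (e \<in> nsets A 2))"
    using edge by (rule sum_mono)
  also have "\<dots> = card M + card (M \<inter> nsets A 2)"
    unfolding sum.distrib using finite_matching[OF M] by (simp add: Int_def)
  finally show ?thesis .
qed

end

definition clique_complement :: "'a set \<Rightarrow> 'a set \<Rightarrow> 'a set set" where
  "clique_complement V A = nsets V 2 - nsets A 2"

lemma simple_graph_clique_complement: "simple_graph V (clique_complement V A)"
  by (auto simp: simple_graph_def clique_complement_def)

lemma min_degree_clique_complement_ge:
  assumes V: "finite V" and A: "A \<subseteq> V" "A \<noteq> {}"
  shows "card V - card A \<le> min_degree V (clique_complement V A)"
proof -
  interpret finite_simple_graph V "clique_complement V A"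
    using V simple_graph_clique_complement by unfold_locales
  have "card V - card A \<le> degree (clique_complement V A) v" if v: "v \<in> V" for v
  proof -
    let ?S = "if v \<in> A then V - A else V - {v}"
    have "finite A" "0 < card A"
      using A finite_subset[OF A(1) V] by (auto simp: card_gt_0_iff)
    then have "card V - card A \<le> card ?S"
      using v A by (auto simp: card_Diff_subset Suc_le_eq intro!: diff_le_mono2)
    also have "\<dots> \<le> card (neighbours (clique_complement V A) v)"
    proof (rule card_mono)
      show "finite (neighbours (clique_complement V A) v)"
        using V by (rule finite_subset[rotated]) (auto simp: neighbours_def clique_complement_def)
      show "?S \<subseteq> neighbours (clique_complement V A) v"
        using v A by (auto simp: neighbours_def clique_complement_def)
    qed
    finally show ?thesis by (simp add: card_neighbours)
  qed
  then show ?thesis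
    unfolding min_degree_def using V A by (subst Min_ge_iff) auto
qed

lemma perfect_matching_clique_complement_imp:
  assumes V: "finite V" and A: "A \<subseteq> V" and G: "G \<subseteq> nsets V 2"
    and perfect: "has_perfect_matching V (clique_complement V A \<union> G)"
  shows "card A - card V div 2 \<le> card (G \<inter> nsets A 2)"
proof -
  interpret finite_simple_graph V "clique_complement V A \<union> G"
    using V G by unfold_locales (auto simp: simple_graph_def clique_complement_def)
  obtain M where M: "matching (clique_complement V A \<union> G) M" "2 * card M = card V"
    using perfect by (auto simp: has_perfect_matching_def perfect_matching_def matching_def)
  have "\<Union>M = V"
    using V Union_matching_subset[OF M(1)] card_Union_matching[OF M(1)] M(2)
    by (intro card_subset_eq) auto
  then have "card A \<le> card M + card (M \<inter> nsets A 2)"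
    using card_covered_le[OF M(1)] A by simp
  also have "card (M \<inter> nsets A 2) \<le> card (G \<inter> nsets A 2)"
    using M(1) finite_subset[OF A V] finite_imp_finite_nsets
    by (intro card_mono) (auto simp: matching_def clique_complement_def)
  finally show ?thesis using M(2) by simp
qed

lemma card_nsets_2_le:
  assumes "finite A"
  shows "real (card (nsets A 2)) \<le> (real (card A))\<^sup>2 / 2"
proof -
  have "2 * card (nsets A 2) \<le> card A * (card A - 1)"
    using assms by (simp add: card_nsets choose_two)
  also have "\<dots> \<le> (card A)\<^sup>2"
    by (simp add: power2_eq_square)
  finally have "real (2 * card (nsets A 2)) \<le> real ((card A)\<^sup>2)"
    by (rule of_nat_mono)
  then show ?thesis by simp
qed

lemma prob_perfect_matching_clique_complement_le:
  assumes V: "finite V" and A: "A \<subseteq> V" and p: "0 \<le> p" "p \<le> 1" and x: "1 \<le> x"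
  shows "measure_pmf.prob (binomial_random_graph V p)
      {G. has_perfect_matching V (clique_complement V A \<union> G)}
    \<le> exp (p * ((real (card A))\<^sup>2 / 2) * (x - 1)) / x ^ (card A - card V div 2)"
proof -
  let ?k = "card A - card V div 2"
  have "measure_pmf.prob (binomial_random_graph V p)
      {G. has_perfect_matching V (clique_complement V A \<union> G)}
    \<le> measure_pmf.prob (random_subset (nsets V 2) p) {G. ?k \<le> card (G \<inter> nsets A 2)}"
    unfolding binomial_random_graph_eq
    using perfect_matching_clique_complement_imp[OF V A]
    by (intro prob_random_subset_mono) auto
  also have "\<dots> \<le> exp (p * card (nsets A 2) * (x - 1)) / x ^ ?k"
    using finite_imp_finite_nsets[OF V] p nsets_mono[OF A] x by (rule prob_card_random_subset_ge)
  also have "\<dots> \<le> exp (p * ((real (card A))\<^sup>2 / 2) * (x - 1)) / x ^ ?k"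
  proof -
    have "p * card (nsets A 2) * (x - 1) \<le> p * ((real (card A))\<^sup>2 / 2) * (x - 1)"
      using p x card_nsets_2_le[OF finite_subset[OF A V]] by (intro mult_left_mono mult_right_mono) auto
    then show ?thesis using x by (intro divide_right_mono) auto
  qed
  finally show ?thesis .
qed

text \<open>The bases \<open>1 + c\<close> here and \<open>1 / (1 - c)\<close> in \<open>exp_div_power_le\<close> are the minimisers of
  \<open>exp (- \<mu> (1 - 1/x)) x\<^sup>h\<close> at \<open>\<mu> = (1 + c) h\<close> and of \<open>exp (\<mu> (x - 1)) / x\<^sup>h\<close> at \<open>\<mu> = (1 - c) h\<close>.\<close>

lemma exp_times_power_le:
  fixes c h \<mu> :: real
  assumes c: "0 < c" and \<mu>: "(1 + c) * h \<le> \<mu>" and m: "real m \<le> h"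
  shows "exp (- (\<mu> * (1 - 1 / (1 + c)))) * (1 + c) ^ m \<le> exp (- ((c - ln (1 + c)) * h))"
proof -
  have "c * h = (1 + c) * h * (1 - 1 / (1 + c))"
    using c by (simp add: field_simps)
  also have "\<dots> \<le> \<mu> * (1 - 1 / (1 + c))"
    using c by (intro mult_right_mono[OF \<mu>]) auto
  finally have "exp (- (\<mu> * (1 - 1 / (1 + c)))) \<le> exp (- (c * h))"
    by simp
  moreover have "(1 + c) ^ m \<le> exp (h * ln (1 + c))"
  proof -
    have "(1 + c) ^ m = exp (m * ln (1 + c))"
      using c by (simp add: exp_of_nat_mult)
    also have "\<dots> \<le> exp (h * ln (1 + c))"
      using c m by (simp add: mult_right_mono)
    finally show ?thesis .
  qed
  ultimately have "exp (- (\<mu> * (1 - 1 / (1 + c)))) * (1 + c) ^ m \<le> exp (- (c * h)) * exp (h * ln (1 + c))"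
    using c by (intro mult_mono) auto
  also have "\<dots> = exp (- ((c - ln (1 + c)) * h))"
    by (simp add: exp_add[symmetric] algebra_simps)
  finally show ?thesis .
qed

lemma prob_perfect_matching_ge:
  fixes h :: real
  assumes n: "even n" and H: "simple_graph {..<n} H"
    and p: "0 \<le> p" "p \<le> 1" and c: "0 < c" and h: "0 \<le> h"
    and deg: "real n / 2 - h \<le> min_degree {..<n} H"
    and large: "(1 + c) * h \<le> p * ((real (min_degree {..<n} H))\<^sup>2 / 2)"
  shows "1 - exp (- ((c - ln (1 + c)) * h)) \<le> prob_perfect_matching n H p"
proof -
  interpret finite_simple_graph "{..<n}" H
    using H by unfold_locales auto
  let ?k = "min_degree {..<n} H"
  have "1 - prob_perfect_matching n H p
    = measure_pmf.prob (binomial_random_graph {..<n} p) {G. \<not> has_perfect_matching {..<n} (H \<union> G)}"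
    using measure_pmf.prob_neg[of "binomial_random_graph {..<n} p" "\<lambda>G. has_perfect_matching {..<n} (H \<union> G)"]
    by (simp add: prob_perfect_matching_def)
  also have "\<dots> \<le> exp (- (p * ((real ?k)\<^sup>2 / 2) * (1 - 1 / (1 + c)))) * (1 + c) ^ (card {..<n} div 2 - ?k)"
    using n p c by (intro prob_no_perfect_matching_le) (auto simp: min_degree_def intro: Min_le)
  also have "\<dots> \<le> exp (- ((c - ln (1 + c)) * h))"
  proof (rule exp_times_power_le[OF c large])
    show "real (card {..<n} div 2 - ?k) \<le> h"
      using deg n h by (cases "?k \<le> n div 2") (auto simp: of_nat_diff real_of_nat_div)
  qed
  finally show ?thesis by simp
qed

definition extremal_graph :: "nat \<Rightarrow> real \<Rightarrow> nat set set" where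
  "extremal_graph n h = clique_complement {..<n} {..<n div 2 + nat \<lfloor>h\<rfloor>}"

lemma simple_graph_extremal_graph: "simple_graph {..<n} (extremal_graph n h)"
  unfolding extremal_graph_def by (rule simple_graph_clique_complement)

lemma half_plus_floor_le:
  fixes h :: real
  assumes "even n" "0 \<le> h" "2 * h \<le> n"
  shows "n div 2 + nat \<lfloor>h\<rfloor> \<le> n" "n div 2 + nat \<lfloor>h\<rfloor> \<le> real n / 2 + h"
proof -
  show "n div 2 + nat \<lfloor>h\<rfloor> \<le> real n / 2 + h"
    using assms by (simp add: real_of_nat_div)
  then have "real (n div 2 + nat \<lfloor>h\<rfloor>) \<le> real n"
    using assms by simp
  then show "n div 2 + nat \<lfloor>h\<rfloor> \<le> n" by linarith
qed

lemma min_degree_extremal_graph_ge: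
  fixes h :: real
  assumes "even n" "1 \<le> h" "2 * h \<le> n"
  shows "real n / 2 - h \<le> min_degree {..<n} (extremal_graph n h)"
proof -
  let ?a = "n div 2 + nat \<lfloor>h\<rfloor>"
  have a: "?a \<le> n" "?a \<le> real n / 2 + h" "0 < ?a"
    using half_plus_floor_le[of n h] assms by auto
  have "real n / 2 - h \<le> real (n - ?a)"
    using a(1,2) by (simp add: of_nat_diff)
  also have "n - ?a \<le> min_degree {..<n} (extremal_graph n h)"
    unfolding extremal_graph_def
    using min_degree_clique_complement_ge[of "{..<n}" "{..<?a}"] a by (auto simp: lessThan_empty_iff)
  finally show ?thesis by simp
qed

lemma exp_div_power_le:
  fixes c h \<mu> :: real
  assumes c: "0 < c" "c < 1" and \<mu>: "\<mu> \<le> (1 - c) * h" and k: "h - 1 \<le> real k"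
  shows "exp (\<mu> * (1 / (1 - c) - 1)) / (1 / (1 - c)) ^ k \<le> exp (- ((- ln (1 - c) - c) * h)) / (1 - c)"
proof -
  have "\<mu> * (1 / (1 - c) - 1) \<le> (1 - c) * h * (1 / (1 - c) - 1)"
    using c by (intro mult_right_mono[OF \<mu>]) auto
  also have "\<dots> = c * h"
    using c by (simp add: field_simps)
  finally have "exp (\<mu> * (1 / (1 - c) - 1)) \<le> exp (c * h)"
    by simp
  moreover have "(1 - c) ^ k \<le> exp ((h - 1) * ln (1 - c))"
  proof -
    have "(1 - c) ^ k = exp (k * ln (1 - c))"
      using c by (simp add: exp_of_nat_mult)
    also have "\<dots> \<le> exp ((h - 1) * ln (1 - c))"
      using c k by (simp add: mult_right_mono_neg)
    finally show ?thesis .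
  qed
  ultimately have "exp (\<mu> * (1 / (1 - c) - 1)) * (1 - c) ^ k \<le> exp (c * h) * exp ((h - 1) * ln (1 - c))"
    using c by (intro mult_mono) auto
  also have "\<dots> = exp (- ((- ln (1 - c) - c) * h) - ln (1 - c))"
    by (simp add: exp_add[symmetric] algebra_simps)
  also have "\<dots> = exp (- ((- ln (1 - c) - c) * h)) / (1 - c)"
    using c by (simp only: exp_diff exp_ln diff_gt_0_iff_gt)
  finally show ?thesis by (simp add: power_divide)
qed

lemma prob_perfect_matching_extremal_graph_le:
  fixes h :: real
  assumes n: "even n" and h: "0 \<le> h" "2 * h \<le> n" and p: "0 \<le> p" "p \<le> 1" and c: "0 < c" "c < 1"
    and small: "p * ((real n / 2 + h)\<^sup>2 / 2) \<le> (1 - c) * h"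
  shows "prob_perfect_matching n (extremal_graph n h) p \<le> exp (- ((- ln (1 - c) - c) * h)) / (1 - c)"
proof -
  let ?a = "n div 2 + nat \<lfloor>h\<rfloor>"
  have a: "?a \<le> n" "?a \<le> real n / 2 + h"
    using half_plus_floor_le[OF n h] by auto
  have "prob_perfect_matching n (extremal_graph n h) p
    \<le> exp (p * ((real ?a)\<^sup>2 / 2) * (1 / (1 - c) - 1)) / (1 / (1 - c)) ^ nat \<lfloor>h\<rfloor>"
    using prob_perfect_matching_clique_complement_le[of "{..<n}" "{..<?a}" p "1 / (1 - c)"] a p c
    by (simp add: prob_perfect_matching_def extremal_graph_def)
  also have "\<dots> \<le> exp (- ((- ln (1 - c) - c) * h)) / (1 - c)"
  proof (rule exp_div_power_le[OF c])
    have "p * ((real ?a)\<^sup>2 / 2) \<le> p * ((real n / 2 + h)\<^sup>2 / 2)"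
      using a p by (intro mult_left_mono divide_right_mono power_mono) auto
    also note small
    finally show "p * ((real ?a)\<^sup>2 / 2) \<le> (1 - c) * h" .
    show "h - 1 \<le> real (nat \<lfloor>h\<rfloor>)"
      using h by linarith
  qed
  finally show ?thesis .
qed

subsection \<open>The threshold\<close>

locale sublinear_gap =
  fixes \<eta> :: "nat \<Rightarrow> real"
  assumes diverges: "filterlim \<eta> at_top even_at_top"
    and sublinear: "\<eta> \<in> o[even_at_top](\<lambda>n. real n)"
begin

lemma perturbed_ratio_tendsto: "((\<lambda>n. s * (1 + t * (\<eta> n / n))\<^sup>2) \<longlongrightarrow> s) even_at_top"
  by (rule tendsto_eq_intros smalloD_tendsto[OF sublinear] refl | simp)+

lemma eventually_in_range: "\<forall>\<^sub>F n in even_at_top. even n \<and> 0 < n \<and> 1 \<le> \<eta> n \<and> 2 * \<eta> n \<le> n"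
proof -
  have "\<forall>\<^sub>F n in even_at_top. even n"
    by (simp add: even_at_top_def eventually_inf_principal)
  moreover have "\<forall>\<^sub>F n in even_at_top. 1 \<le> \<eta> n"
    using diverges by (simp add: filterlim_at_top)
  moreover have "\<forall>\<^sub>F n in even_at_top. norm (\<eta> n) \<le> 1 / 2 * norm (real n)"
    by (rule landau_o.smallD[OF sublinear]) simp
  ultimately show ?thesis
    by eventually_elim (auto intro: gr0I)
qed

lemma exp_decay_tendsto_0:
  assumes "0 < \<kappa>"
  shows "((\<lambda>n. exp (- (\<kappa> * \<eta> n))) \<longlongrightarrow> 0) even_at_top"
proof -
  have "filterlim (\<lambda>n. \<kappa> * \<eta> n) at_top even_at_top"
    using assms diverges by (intro filterlim_tendsto_pos_mult_at_top[OF tendsto_const])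
  then have "filterlim (\<lambda>n. - (\<kappa> * \<eta> n)) at_bot even_at_top"
    by (simp add: filterlim_uminus_at_top)
  then show ?thesis by (rule filterlim_compose[OF exp_at_bot])
qed

lemma prob_perfect_matching_tendsto_1:
  assumes \<epsilon>: "0 < \<epsilon>"
    and H: "\<And>n. even n \<Longrightarrow> simple_graph {..<n} (H n)"
    and deg: "\<forall>\<^sub>F n in even_at_top. real n / 2 - \<eta> n \<le> min_degree {..<n} (H n)"
    and p: "\<And>n. even n \<Longrightarrow> 0 \<le> p n \<and> p n \<le> 1"
    and p_ge: "\<forall>\<^sub>F n in even_at_top. (1 + \<epsilon>) * (8 * \<eta> n / (real n)\<^sup>2) \<le> p n"
  shows "((\<lambda>n. prob_perfect_matching n (H n) (p n)) \<longlongrightarrow> 1) even_at_top"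
proof -
  define c where "c = \<epsilon> / 2"
  define \<kappa> where "\<kappa> = c - ln (1 + c)"
  have c: "0 < c" "1 + c < 1 + \<epsilon>" using \<epsilon> by (auto simp: c_def)
  have \<kappa>: "0 < \<kappa>" using ln_add_one_self_less_self[OF c(1)] by (simp add: \<kappa>_def)
  have "\<forall>\<^sub>F n in even_at_top. 1 + c < (1 + \<epsilon>) * (1 + - 2 * (\<eta> n / n))\<^sup>2"
    using perturbed_ratio_tendsto c(2) by (rule order_tendstoD(1))
  then have bound: "\<forall>\<^sub>F n in even_at_top. 1 - exp (- (\<kappa> * \<eta> n)) \<le> prob_perfect_matching n (H n) (p n)"
    using eventually_in_range deg p_ge
  proof eventually_elim
    case (elim n)
    let ?k = "real (min_degree {..<n} (H n))"
    have pn: "0 \<le> p n" "p n \<le> 1" using p elim by auto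
    have "(1 + c) * \<eta> n \<le> (1 + \<epsilon>) * (1 + - 2 * (\<eta> n / n))\<^sup>2 * \<eta> n"
      using elim by (intro mult_right_mono) auto
    also have "\<dots> = (1 + \<epsilon>) * (8 * \<eta> n / (real n)\<^sup>2) * ((real n / 2 - \<eta> n)\<^sup>2 / 2)"
      using elim by (simp add: power2_eq_square field_simps)
    also have "\<dots> \<le> p n * (?k\<^sup>2 / 2)"
      using elim pn by (intro mult_mono divide_right_mono power_mono) auto
    finally show ?case
      unfolding \<kappa>_def using elim pn c H by (intro prob_perfect_matching_ge) auto
  qed
  show ?thesis
  proof (rule tendsto_sandwich[OF bound])
    show "\<forall>\<^sub>F n in even_at_top. prob_perfect_matching n (H n) (p n) \<le> 1"
      by (simp add: prob_perfect_matching_def)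
    show "((\<lambda>n. 1 - exp (- (\<kappa> * \<eta> n))) \<longlongrightarrow> 1) even_at_top"
      using tendsto_diff[OF tendsto_const exp_decay_tendsto_0[OF \<kappa>], of 1] by simp
  qed simp
qed

lemma prob_extremal_graph_tendsto_0:
  assumes \<epsilon>: "0 < \<epsilon>"
    and p: "\<And>n. even n \<Longrightarrow> 0 \<le> p n \<and> p n \<le> 1"
    and p_le: "\<forall>\<^sub>F n in even_at_top. p n \<le> (1 - \<epsilon>) * (8 * \<eta> n / (real n)\<^sup>2)"
  shows "((\<lambda>n. prob_perfect_matching n (extremal_graph n (\<eta> n)) (p n)) \<longlongrightarrow> 0) even_at_top"
proof -
  define c where "c = min \<epsilon> 1 / 2"
  define \<kappa> where "\<kappa> = - ln (1 - c) - c"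
  have c: "0 < c" "c < 1" "1 - \<epsilon> < 1 - c" using \<epsilon> by (auto simp: c_def)
  have "1 - c < exp (- c)" using c by (simp add: exp_minus_greater)
  then have \<kappa>: "0 < \<kappa>" using c ln_less_cancel_iff[of "1 - c" "exp (- c)"] by (simp add: \<kappa>_def)
  have "\<forall>\<^sub>F n in even_at_top. (1 - \<epsilon>) * (1 + 2 * (\<eta> n / n))\<^sup>2 < 1 - c"
    using perturbed_ratio_tendsto c(3) by (rule order_tendstoD(2))
  then have bound: "\<forall>\<^sub>F n in even_at_top.
      prob_perfect_matching n (extremal_graph n (\<eta> n)) (p n) \<le> exp (- (\<kappa> * \<eta> n)) / (1 - c)"
    using eventually_in_range p_le
  proof eventually_elim
    case (elim n)
    have pn: "0 \<le> p n" "p n \<le> 1" using p elim by auto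
    have "p n * ((real n / 2 + \<eta> n)\<^sup>2 / 2) \<le> (1 - \<epsilon>) * (8 * \<eta> n / (real n)\<^sup>2) * ((real n / 2 + \<eta> n)\<^sup>2 / 2)"
      using elim by (intro mult_right_mono) auto
    also have "\<dots> = (1 - \<epsilon>) * (1 + 2 * (\<eta> n / n))\<^sup>2 * \<eta> n"
      using elim by (simp add: power2_eq_square field_simps)
    also have "\<dots> \<le> (1 - c) * \<eta> n"
      using elim by (intro mult_right_mono) auto
    finally show ?case
      unfolding \<kappa>_def using elim pn c by (intro prob_perfect_matching_extremal_graph_le) auto
  qed
  show ?thesis
  proof (rule tendsto_sandwich[OF _ bound tendsto_const])
    show "\<forall>\<^sub>F n in even_at_top. 0 \<le> prob_perfect_matching n (extremal_graph n (\<eta> n)) (p n)"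
      by (simp add: prob_perfect_matching_def)
    show "((\<lambda>n. exp (- (\<kappa> * \<eta> n)) / (1 - c)) \<longlongrightarrow> 0) even_at_top"
      using tendsto_divide[OF exp_decay_tendsto_0[OF \<kappa>] tendsto_const[of "1 - c"]] c by simp
  qed
qed

lemma eventually_min_degree_extremal_graph_ge:
  "\<forall>\<^sub>F n in even_at_top. real n / 2 - \<eta> n \<le> min_degree {..<n} (extremal_graph n (\<eta> n))"
  using eventually_in_range by eventually_elim (use min_degree_extremal_graph_ge in blast)

end

theorem theorem1p5:
  fixes \<eta> d :: "nat \<Rightarrow> real"
  assumes eta_omega: "filterlim \<eta> at_top even_at_top"
    and eta_o: "\<eta> \<in> o[even_at_top](\<lambda>n. real n)"
    and d_eq: "\<And>n. even n \<Longrightarrow> d n = real n / 2 - \<eta> n"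
  shows "\<forall>\<epsilon>>0.
    (\<exists>H :: nat \<Rightarrow> nat set set.
        (\<forall>n. even n \<longrightarrow> simple_graph {..<n} (H n)) \<and>
        (\<forall>\<^sub>F n in even_at_top. real (min_degree {..<n} (H n)) \<ge> d n) \<and>
        (\<forall>p :: nat \<Rightarrow> real.
            (\<forall>n. even n \<longrightarrow> 0 \<le> p n \<and> p n \<le> 1) \<longrightarrow>
            (\<forall>\<^sub>F n in even_at_top. p n \<le> (1 - \<epsilon>) * (8 * \<eta> n / (real n)\<^sup>2)) \<longrightarrow>
            ((\<lambda>n. prob_perfect_matching n (H n) (p n)) \<longlongrightarrow> 0) even_at_top)) \<and>
    (\<forall>H :: nat \<Rightarrow> nat set set.
        (\<forall>n. even n \<longrightarrow> simple_graph {..<n} (H n)) \<longrightarrow>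
        (\<forall>\<^sub>F n in even_at_top. real (min_degree {..<n} (H n)) \<ge> d n) \<longrightarrow>
        (\<forall>p :: nat \<Rightarrow> real.
            (\<forall>n. even n \<longrightarrow> 0 \<le> p n \<and> p n \<le> 1) \<longrightarrow>
            (\<forall>\<^sub>F n in even_at_top. p n \<ge> (1 + \<epsilon>) * (8 * \<eta> n / (real n)\<^sup>2)) \<longrightarrow>
            ((\<lambda>n. prob_perfect_matching n (H n) (p n)) \<longlongrightarrow> 1) even_at_top))"
proof (intro allI impI conjI exI[of _ "\<lambda>n. extremal_graph n (\<eta> n)"])
  interpret sublinear_gap \<eta>
    using eta_omega eta_o by unfold_locales
  have d_eventually: "\<forall>\<^sub>F n in even_at_top. d n = real n / 2 - \<eta> n"
    using eventually_in_range by eventually_elim (simp add: d_eq)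
  fix \<epsilon> :: real assume \<epsilon>: "0 < \<epsilon>"
  show "simple_graph {..<n} (extremal_graph n (\<eta> n))" for n
    by (rule simple_graph_extremal_graph)
  show "\<forall>\<^sub>F n in even_at_top. real (min_degree {..<n} (extremal_graph n (\<eta> n))) \<ge> d n"
    using d_eventually eventually_min_degree_extremal_graph_ge by eventually_elim simp
  fix p :: "nat \<Rightarrow> real"
  assume p: "\<forall>n. even n \<longrightarrow> 0 \<le> p n \<and> p n \<le> 1"
  show "((\<lambda>n. prob_perfect_matching n (extremal_graph n (\<eta> n)) (p n)) \<longlongrightarrow> 0) even_at_top"
    if "\<forall>\<^sub>F n in even_at_top. p n \<le> (1 - \<epsilon>) * (8 * \<eta> n / (real n)\<^sup>2)"
    using \<epsilon> p that by (intro prob_extremal_graph_tendsto_0) auto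
  fix H :: "nat \<Rightarrow> nat set set"
  assume H: "\<forall>n. even n \<longrightarrow> simple_graph {..<n} (H n)"
    and deg: "\<forall>\<^sub>F n in even_at_top. real (min_degree {..<n} (H n)) \<ge> d n"
  have "\<forall>\<^sub>F n in even_at_top. real n / 2 - \<eta> n \<le> min_degree {..<n} (H n)"
    using deg d_eventually by eventually_elim simp
  then show "((\<lambda>n. prob_perfect_matching n (H n) (p n)) \<longlongrightarrow> 1) even_at_top"
    if "\<forall>\<^sub>F n in even_at_top. p n \<ge> (1 + \<epsilon>) * (8 * \<eta> n / (real n)\<^sup>2)"
    using \<epsilon> H p that by (intro prob_perfect_matching_tendsto_1) auto
qed

end
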